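(* Let $L$ be an MV-algebra and $a\in B(L)$. Then the MV-algebra $L$ is isomorphic to the direct product of the MV-algebras $(Fix_{d_a}(L),\oplus,\neg_1,0,a)$ and $(Fix_{g_a}(L),\oplus,\circ_1,a,1)$.
   Context: An MV-algebra is an algebra $(L,\oplus,{}^\ast,0)$ of type $(2,1,0)$ such that $(L,\oplus,0)$ is a commutative monoid, $(x^\ast)^\ast=x$, $0^\ast\oplus x=0^\ast$, and $(x^\ast\oplus y)^\ast\oplus y=(y^\ast\oplus x)^\ast\oplus x$ for all $x,y\in L$. Put $1=0^\ast$, $x\odot y=(x^\ast\oplus y^\ast)^\ast$. The Boolean center is $B(L)=\{a\in L\mid a\oplus a=a\}$. For $a\in L$ define maps $L\to L$ by $d_a(x)=x\odot a$ and $g_a(x)=a\oplus x$. For a map $f:L\to L$, $Fix_f(L)=\{x\in L\mid f(x)=x\}$. For $a\in B(L)$: $(Fix_{d_a}(L),\oplus,\neg_1,0,a)$ is the MV-algebra with the addition $\oplus$ of $L$, negation $\neg_1x=d_a(x^\ast)$, zero element $0$ and unit (top) $a$; $(Fix_{g_a}(L),\oplus,\circ_1,a,1)$ is the MV-algebra with the addition $\oplus$ of $L$, negation $x^{\circ_1}=g_a(x^\ast)$, zero element $a$ and unit (top) $1$. *)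

theory Defs
  imports "HOL-Algebra.Congruence"
begin

record 'a mv_struct = "'a partial_object" +
  mv_plus :: "'a \<Rightarrow> 'a \<Rightarrow> 'a"  (infixl \<open>\<oplus>\<index>\<close> 65)
  mv_neg :: "'a \<Rightarrow> 'a"  (\<open>\<sim>\<index> _\<close> [81] 80)
  mv_zero :: 'a  (\<open>\<zero>\<index>\<close>)

locale mv_algebra =
  fixes L (structure)
  assumes plus_closed: "\<lbrakk>x \<in> carrier L; y \<in> carrier L\<rbrakk> \<Longrightarrow> x \<oplus> y \<in> carrier L"
    and neg_closed: "x \<in> carrier L \<Longrightarrow> \<sim> x \<in> carrier L"
    and zero_closed: "\<zero> \<in> carrier L"
    and plus_assoc:
      "\<lbrakk>x \<in> carrier L; y \<in> carrier L; z \<in> carrier L\<rbrakk> \<Longrightarrow> (x \<oplus> y) \<oplus> z = x \<oplus> (y \<oplus> z)"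
    and plus_comm: "\<lbrakk>x \<in> carrier L; y \<in> carrier L\<rbrakk> \<Longrightarrow> x \<oplus> y = y \<oplus> x"
    and plus_zero: "x \<in> carrier L \<Longrightarrow> x \<oplus> \<zero> = x"
    and neg_neg: "x \<in> carrier L \<Longrightarrow> \<sim> (\<sim> x) = x"
    and neg_zero_plus: "x \<in> carrier L \<Longrightarrow> (\<sim> \<zero>) \<oplus> x = \<sim> \<zero>"
    and lukasiewicz:
      "\<lbrakk>x \<in> carrier L; y \<in> carrier L\<rbrakk> \<Longrightarrow> \<sim> (\<sim> x \<oplus> y) \<oplus> y = \<sim> (\<sim> y \<oplus> x) \<oplus> x"

definition mv_one :: "('a, 'm) mv_struct_scheme \<Rightarrow> 'a"  (\<open>\<one>\<index>\<close>)
  where "\<one>\<^bsub>L\<^esub> = \<sim>\<^bsub>L\<^esub> \<zero>\<^bsub>L\<^esub>"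

definition mv_times :: "('a, 'm) mv_struct_scheme \<Rightarrow> 'a \<Rightarrow> 'a \<Rightarrow> 'a"  (infixl \<open>\<odot>\<index>\<close> 70)
  where "x \<odot>\<^bsub>L\<^esub> y = \<sim>\<^bsub>L\<^esub> (\<sim>\<^bsub>L\<^esub> x \<oplus>\<^bsub>L\<^esub> \<sim>\<^bsub>L\<^esub> y)"

definition boolean_center :: "('a, 'm) mv_struct_scheme \<Rightarrow> 'a set"
  where "boolean_center L = {a \<in> carrier L. a \<oplus>\<^bsub>L\<^esub> a = a}"

definition d_map :: "('a, 'm) mv_struct_scheme \<Rightarrow> 'a \<Rightarrow> 'a \<Rightarrow> 'a"
  where "d_map L a x = x \<odot>\<^bsub>L\<^esub> a"

definition g_map :: "('a, 'm) mv_struct_scheme \<Rightarrow> 'a \<Rightarrow> 'a \<Rightarrow> 'a"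
  where "g_map L a x = a \<oplus>\<^bsub>L\<^esub> x"

definition Fix :: "('a \<Rightarrow> 'a) \<Rightarrow> ('a, 'm) mv_struct_scheme \<Rightarrow> 'a set"
  where "Fix f L = {x \<in> carrier L. f x = x}"

text \<open>The unit of an MV-algebra is not a field of the record but the derived element
  \<open>\<one> = \<sim> \<zero>\<close>; that it is \<open>a\<close> in \<open>Fix_d\<close> and \<open>\<one>\<close> in \<open>Fix_g\<close> is shown in
  \<open>one_Fix_d\<close> and \<open>one_Fix_g\<close> below.\<close>

definition Fix_d :: "('a, 'm) mv_struct_scheme \<Rightarrow> 'a \<Rightarrow> 'a mv_struct"
  where "Fix_d L a =
    \<lparr>carrier = Fix (d_map L a) L,
     mv_plus = mv_plus L,
     mv_neg = (\<lambda>x. d_map L a (\<sim>\<^bsub>L\<^esub> x)),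
     mv_zero = \<zero>\<^bsub>L\<^esub>\<rparr>"

definition Fix_g :: "('a, 'm) mv_struct_scheme \<Rightarrow> 'a \<Rightarrow> 'a mv_struct"
  where "Fix_g L a =
    \<lparr>carrier = Fix (g_map L a) L,
     mv_plus = mv_plus L,
     mv_neg = (\<lambda>x. g_map L a (\<sim>\<^bsub>L\<^esub> x)),
     mv_zero = a\<rparr>"

definition mv_prod ::
    "('a, 'm) mv_struct_scheme \<Rightarrow> ('b, 'n) mv_struct_scheme \<Rightarrow> ('a \<times> 'b) mv_struct"
    (infixr \<open>\<times>\<^sub>M\<^sub>V\<close> 80)
  where "M \<times>\<^sub>M\<^sub>V N =
    \<lparr>carrier = carrier M \<times> carrier N,
     mv_plus = (\<lambda>(x, y) (x', y'). (x \<oplus>\<^bsub>M\<^esub> x', y \<oplus>\<^bsub>N\<^esub> y')),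
     mv_neg = (\<lambda>(x, y). (\<sim>\<^bsub>M\<^esub> x, \<sim>\<^bsub>N\<^esub> y)),
     mv_zero = (\<zero>\<^bsub>M\<^esub>, \<zero>\<^bsub>N\<^esub>)\<rparr>"

definition mv_hom ::
    "('a, 'm) mv_struct_scheme \<Rightarrow> ('b, 'n) mv_struct_scheme \<Rightarrow> ('a \<Rightarrow> 'b) set"
  where "mv_hom M N =
    {h. h \<in> carrier M \<rightarrow> carrier N \<and>
        (\<forall>x\<in>carrier M. \<forall>y\<in>carrier M. h (x \<oplus>\<^bsub>M\<^esub> y) = h x \<oplus>\<^bsub>N\<^esub> h y) \<and>
        (\<forall>x\<in>carrier M. h (\<sim>\<^bsub>M\<^esub> x) = \<sim>\<^bsub>N\<^esub> (h x)) \<and>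
        h \<zero>\<^bsub>M\<^esub> = \<zero>\<^bsub>N\<^esub>}"

definition mv_iso ::
    "('a, 'm) mv_struct_scheme \<Rightarrow> ('b, 'n) mv_struct_scheme \<Rightarrow> ('a \<Rightarrow> 'b) set"
  where "mv_iso M N = {h. h \<in> mv_hom M N \<and> bij_betw h (carrier M) (carrier N)}"

definition mv_isomorphic ::
    "('a, 'm) mv_struct_scheme \<Rightarrow> ('b, 'n) mv_struct_scheme \<Rightarrow> bool"  (infix \<open>\<cong>\<^sub>M\<^sub>V\<close> 60)
  where "M \<cong>\<^sub>M\<^sub>V N \<longleftrightarrow> mv_iso M N \<noteq> {}"

subsection \<open>The structures above are MV-algebras\<close>

lemma mv_algebra_prod:
  assumes "mv_algebra M" "mv_algebra N"
  shows "mv_algebra (M \<times>\<^sub>M\<^sub>V N)"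
proof -
  interpret M: mv_algebra M by fact
  interpret N: mv_algebra N by fact
  show ?thesis
    by unfold_locales
      (auto simp: mv_prod_def M.plus_closed N.plus_closed M.neg_closed N.neg_closed
        M.zero_closed N.zero_closed M.plus_assoc N.plus_assoc M.plus_zero N.plus_zero
        M.neg_neg N.neg_neg M.neg_zero_plus N.neg_zero_plus
        intro: M.plus_comm N.plus_comm M.lukasiewicz N.lukasiewicz)
qed

lemma mv_algebra_hom_image:
  assumes "mv_algebra M" and h: "h \<in> mv_hom M N" and surj: "carrier N = h ` carrier M"
  shows "mv_algebra N"
proof -
  interpret M: mv_algebra M by fact
  have p: "h x \<oplus>\<^bsub>N\<^esub> h y = h (x \<oplus>\<^bsub>M\<^esub> y)" if "x \<in> carrier M" "y \<in> carrier M" for x y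
    using h that by (simp add: mv_hom_def)
  have n: "\<sim>\<^bsub>N\<^esub> (h x) = h (\<sim>\<^bsub>M\<^esub> x)" if "x \<in> carrier M" for x
    using h that by (simp add: mv_hom_def)
  have z: "\<zero>\<^bsub>N\<^esub> = h \<zero>\<^bsub>M\<^esub>"
    using h by (simp add: mv_hom_def)
  show ?thesis
    by unfold_locales
      (auto simp: surj p n z M.plus_closed M.neg_closed M.zero_closed M.plus_assoc M.plus_zero
        M.neg_neg M.neg_zero_plus intro!: arg_cong[where f = h] intro: M.plus_comm M.lukasiewicz)
qed

context mv_algebra
begin

lemmas closed = plus_closed neg_closed zero_closed

lemma plus_left_comm:
  "\<lbrakk>x \<in> carrier L; y \<in> carrier L; z \<in> carrier L\<rbrakk> \<Longrightarrow> x \<oplus> (y \<oplus> z) = y \<oplus> (x \<oplus> z)"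
  by (metis plus_assoc plus_comm)

lemmas plus_ac = plus_assoc plus_comm plus_left_comm

lemma zero_plus: "x \<in> carrier L \<Longrightarrow> \<zero> \<oplus> x = x"
  by (metis plus_comm plus_zero zero_closed)

lemma one_closed: "\<one> \<in> carrier L"
  by (simp add: mv_one_def closed)

lemma one_plus: "x \<in> carrier L \<Longrightarrow> \<one> \<oplus> x = \<one>"
  by (simp add: mv_one_def neg_zero_plus)

lemma plus_one: "x \<in> carrier L \<Longrightarrow> x \<oplus> \<one> = \<one>"
  by (metis one_closed one_plus plus_comm)

lemma neg_one: "\<sim> \<one> = \<zero>"
  by (simp add: mv_one_def neg_neg closed)

lemma neg_plus_self: "x \<in> carrier L \<Longrightarrow> \<sim> x \<oplus> x = \<one>"
  using lukasiewicz[of x "\<one>"]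
  by (simp add: plus_one one_closed closed neg_one zero_plus)

lemma plus_neg_self: "x \<in> carrier L \<Longrightarrow> x \<oplus> \<sim> x = \<one>"
  by (metis neg_closed neg_plus_self plus_comm)

definition le (infix \<open>\<preceq>\<close> 50)
  where "x \<preceq> y \<longleftrightarrow> \<sim> x \<oplus> y = \<one>"

lemma le_antisym: "\<lbrakk>x \<preceq> y; y \<preceq> x; x \<in> carrier L; y \<in> carrier L\<rbrakk> \<Longrightarrow> x = y"
  using lukasiewicz[of x y] by (simp add: le_def neg_one zero_plus)

lemma le_plus: "\<lbrakk>x \<in> carrier L; y \<in> carrier L\<rbrakk> \<Longrightarrow> x \<preceq> x \<oplus> y"
  by (simp add: le_def plus_assoc[symmetric] neg_plus_self one_plus closed)

lemma le_split: "\<lbrakk>x \<preceq> y; x \<in> carrier L; y \<in> carrier L\<rbrakk> \<Longrightarrow> \<exists>z\<in>carrier L. y = x \<oplus> z"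
  using lukasiewicz[of x y]
  by (metis closed le_def neg_one plus_comm zero_plus)

lemma le_trans:
  assumes "x \<preceq> y" "y \<preceq> z" "x \<in> carrier L" "y \<in> carrier L" "z \<in> carrier L"
  shows "x \<preceq> z"
proof -
  obtain u where u: "u \<in> carrier L" "y = x \<oplus> u" using le_split assms by blast
  obtain v where v: "v \<in> carrier L" "z = y \<oplus> v" using le_split assms by blast
  show ?thesis using u v assms by (simp add: plus_assoc le_plus closed)
qed

lemma plus_mono:
  assumes "x \<preceq> x'" "y \<preceq> y'" and c: "x \<in> carrier L" "x' \<in> carrier L" "y \<in> carrier L" "y' \<in> carrier L"
  shows "x \<oplus> y \<preceq> x' \<oplus> y'"
proof -
  obtain u where u: "u \<in> carrier L" "x' = x \<oplus> u" using le_split assms by blast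
  obtain v where v: "v \<in> carrier L" "y' = y \<oplus> v" using le_split assms by blast
  have "x' \<oplus> y' = (x \<oplus> y) \<oplus> (u \<oplus> v)" using u v c by (simp add: plus_ac closed)
  then show ?thesis using u v c by (simp add: le_plus closed)
qed

lemma times_closed: "\<lbrakk>x \<in> carrier L; y \<in> carrier L\<rbrakk> \<Longrightarrow> x \<odot> y \<in> carrier L"
  by (simp add: mv_times_def closed)

lemma times_comm: "\<lbrakk>x \<in> carrier L; y \<in> carrier L\<rbrakk> \<Longrightarrow> x \<odot> y = y \<odot> x"
  by (simp add: mv_times_def plus_comm closed)

lemma times_assoc:
  "\<lbrakk>x \<in> carrier L; y \<in> carrier L; z \<in> carrier L\<rbrakk> \<Longrightarrow> (x \<odot> y) \<odot> z = x \<odot> (y \<odot> z)"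
  by (simp add: mv_times_def plus_assoc neg_neg closed)

lemma times_le: "\<lbrakk>x \<in> carrier L; y \<in> carrier L\<rbrakk> \<Longrightarrow> x \<odot> y \<preceq> x"
  by (simp add: le_def mv_times_def neg_neg closed plus_comm[of "\<sim> x \<oplus> \<sim> y" x])
    (simp add: plus_assoc[symmetric] closed plus_neg_self one_plus)

lemma times_le_iff:
  "\<lbrakk>x \<in> carrier L; y \<in> carrier L; z \<in> carrier L\<rbrakk> \<Longrightarrow> x \<odot> y \<preceq> z \<longleftrightarrow> x \<preceq> \<sim> y \<oplus> z"
  by (simp add: le_def mv_times_def neg_neg closed plus_assoc)

lemma boolean_neg:
  assumes "a \<in> boolean_center L"
  shows "\<sim> a \<in> boolean_center L"
proof -
  have a: "a \<in> carrier L" "a \<oplus> a = a" using assms by (auto simp: boolean_center_def)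
  have "\<sim> (\<sim> a \<oplus> \<sim> a) \<oplus> \<sim> a = \<one>"
    using lukasiewicz[of a "\<sim> a"] a by (simp add: neg_neg closed neg_plus_self)
  then have "\<sim> a \<oplus> \<sim> a \<preceq> \<sim> a" by (simp add: le_def)
  then have "\<sim> a \<oplus> \<sim> a = \<sim> a" using a by (intro le_antisym le_plus closed)
  then show ?thesis using a by (simp add: boolean_center_def closed)
qed

lemma boolean_times: "a \<in> boolean_center L \<Longrightarrow> a \<odot> a = a"
  using boolean_neg[of a] by (auto simp: boolean_center_def mv_times_def neg_neg)

lemma le_join: "\<lbrakk>x \<in> carrier L; y \<in> carrier L\<rbrakk> \<Longrightarrow> x \<preceq> \<sim> y \<oplus> (x \<odot> y)"
  using times_le_iff[of x y "x \<odot> y"] by (simp add: times_closed le_def neg_plus_self)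

lemma plus_times_boolean:
  assumes "a \<in> boolean_center L" and x: "x \<in> carrier L" and y: "y \<in> carrier L"
  shows "(x \<oplus> y) \<odot> a = (x \<odot> a) \<oplus> (y \<odot> a)"
proof (rule le_antisym)
  have a: "a \<in> carrier L" "a \<oplus> a = a" using assms by (auto simp: boolean_center_def)
  have na: "\<sim> a \<oplus> \<sim> a = \<sim> a" using boolean_neg[OF assms(1)] by (simp add: boolean_center_def)
  have c: "x \<odot> a \<in> carrier L" "y \<odot> a \<in> carrier L" using a x y by (auto intro: times_closed)
  show "(x \<oplus> y) \<odot> a \<in> carrier L" "(x \<odot> a) \<oplus> (y \<odot> a) \<in> carrier L"
    using a x y c by (auto intro: times_closed closed)
  have "x \<oplus> y \<preceq> (\<sim> a \<oplus> (x \<odot> a)) \<oplus> (\<sim> a \<oplus> (y \<odot> a))"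
    using a x y c by (intro plus_mono le_join closed)
  also have "(\<sim> a \<oplus> (x \<odot> a)) \<oplus> (\<sim> a \<oplus> (y \<odot> a)) = (\<sim> a \<oplus> \<sim> a) \<oplus> ((x \<odot> a) \<oplus> (y \<odot> a))"
    using a c by (simp add: plus_ac closed)
  finally show "(x \<oplus> y) \<odot> a \<preceq> (x \<odot> a) \<oplus> (y \<odot> a)"
    using a x y c na by (simp add: times_le_iff closed)
  have idem: "u \<odot> a = u" if u: "u \<preceq> a" "u \<in> carrier L" for u
  proof -
    have "u \<oplus> a = a"
    proof (rule le_antisym)
      show "u \<oplus> a \<preceq> a" using plus_mono[of u a a a] u a by (simp add: le_def neg_plus_self)
      show "a \<preceq> u \<oplus> a" using le_plus[of a u] u a by (simp add: plus_comm)
    qed (use u a in \<open>auto intro: closed\<close>)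
    then have "u \<preceq> u \<odot> a"
      using lukasiewicz[of a "\<sim> u"] u a
      by (simp add: le_def mv_times_def plus_comm neg_neg closed plus_neg_self)
    then show ?thesis using u a by (intro le_antisym times_le times_closed)
  qed
  have "x \<odot> a \<preceq> a" "y \<odot> a \<preceq> a" using a x y times_le by (metis times_comm)+
  then have "(x \<odot> a) \<oplus> (y \<odot> a) \<preceq> a" using plus_mono[of "x \<odot> a" a "y \<odot> a" a] a c by simp
  then have "((x \<odot> a) \<oplus> (y \<odot> a)) \<odot> a = (x \<odot> a) \<oplus> (y \<odot> a)" using c by (intro idem closed)
  moreover have "(x \<odot> a) \<oplus> (y \<odot> a) \<preceq> x \<oplus> y" using a x y c by (intro plus_mono times_le)
  then have "((x \<odot> a) \<oplus> (y \<odot> a)) \<odot> a \<preceq> (x \<oplus> y) \<odot> a"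
  proof -
    assume le: "(x \<odot> a) \<oplus> (y \<odot> a) \<preceq> x \<oplus> y"
    have "x \<oplus> y \<preceq> \<sim> a \<oplus> ((x \<oplus> y) \<odot> a)" using a x y by (intro le_join closed)
    then show ?thesis using le a x y c times_le_iff le_trans
      by (meson plus_closed neg_closed times_closed)
  qed
  ultimately show "(x \<odot> a) \<oplus> (y \<odot> a) \<preceq> (x \<oplus> y) \<odot> a" by simp
qed

lemma times_neg_self: "x \<in> carrier L \<Longrightarrow> \<sim> x \<odot> x = \<zero>"
  by (simp add: mv_times_def neg_neg closed plus_neg_self neg_one)

lemma neg_times_boolean:
  assumes "a \<in> boolean_center L" and x: "x \<in> carrier L"
  shows "\<sim> (x \<odot> a) \<odot> a = \<sim> x \<odot> a"
proof -
  have a: "a \<in> carrier L" using assms by (auto simp: boolean_center_def)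
  have "\<sim> (x \<odot> a) = \<sim> x \<oplus> \<sim> a" using a x by (simp add: mv_times_def neg_neg closed)
  then show ?thesis
    using assms a by (simp add: plus_times_boolean closed times_neg_self plus_zero times_closed)
qed

lemma d_map_hom:
  assumes "a \<in> boolean_center L"
  shows "d_map L a \<in> mv_hom L (Fix_d L a)" and "carrier (Fix_d L a) = d_map L a ` carrier L"
proof -
  have a: "a \<in> carrier L" using assms by (auto simp: boolean_center_def)
  have inFix: "d_map L a x \<in> Fix (d_map L a) L" if "x \<in> carrier L" for x
    using that a boolean_times[OF assms] by (simp add: Fix_def d_map_def times_assoc times_closed)
  have "\<zero> \<odot> a = \<zero>"
    using a by (simp add: mv_times_def) (metis mv_one_def neg_one one_plus neg_closed)
  then show "d_map L a \<in> mv_hom L (Fix_d L a)"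
    using inFix plus_times_boolean[OF assms] neg_times_boolean[OF assms]
    by (simp add: mv_hom_def Fix_d_def) (simp add: d_map_def)
  show "carrier (Fix_d L a) = d_map L a ` carrier L"
    using inFix unfolding Fix_d_def Fix_def by (auto simp: image_iff) (metis)
qed

lemma g_map_hom:
  assumes "a \<in> boolean_center L"
  shows "g_map L a \<in> mv_hom L (Fix_g L a)" and "carrier (Fix_g L a) = g_map L a ` carrier L"
proof -
  have a: "a \<in> carrier L" "a \<oplus> a = a" using assms by (auto simp: boolean_center_def)
  have aa: "a \<oplus> (a \<oplus> x) = a \<oplus> x" if "x \<in> carrier L" for x
    using that a by (metis plus_assoc)
  have inFix: "g_map L a x \<in> Fix (g_map L a) L" if "x \<in> carrier L" for x
    using that a aa by (simp add: Fix_def g_map_def closed)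
  have plus: "a \<oplus> (x \<oplus> y) = (a \<oplus> x) \<oplus> (a \<oplus> y)" if "x \<in> carrier L" "y \<in> carrier L" for x y
    using that a aa[of "x \<oplus> y"] by (simp add: plus_assoc closed plus_left_comm[of x a y])
  have neg: "a \<oplus> \<sim> (a \<oplus> x) = a \<oplus> \<sim> x" if x: "x \<in> carrier L" for x
  proof -
    have "\<sim> (\<sim> x \<odot> \<sim> a) \<odot> \<sim> a = \<sim> (\<sim> x) \<odot> \<sim> a"
      using x by (intro neg_times_boolean boolean_neg assms closed)
    then have "\<sim> (\<sim> (x \<oplus> a) \<oplus> a) = \<sim> (\<sim> x \<oplus> a)"
      using a x by (simp add: mv_times_def neg_neg closed)
    then have "\<sim> (x \<oplus> a) \<oplus> a = \<sim> x \<oplus> a"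
      using a x by (metis neg_neg closed)
    then show ?thesis using a x by (simp add: plus_comm closed)
  qed
  show "g_map L a \<in> mv_hom L (Fix_g L a)"
    using inFix plus neg a by (simp add: mv_hom_def Fix_g_def) (simp add: g_map_def plus_zero)
  show "carrier (Fix_g L a) = g_map L a ` carrier L"
    using inFix unfolding Fix_g_def Fix_def by (auto simp: image_iff) (metis)
qed

theorem mv_algebra_Fix_d: "a \<in> boolean_center L \<Longrightarrow> mv_algebra (Fix_d L a)"
  using mv_algebra_hom_image d_map_hom mv_algebra_axioms by blast

theorem mv_algebra_Fix_g: "a \<in> boolean_center L \<Longrightarrow> mv_algebra (Fix_g L a)"
  using mv_algebra_hom_image g_map_hom mv_algebra_axioms by blast

lemma one_Fix_d: "a \<in> carrier L \<Longrightarrow> \<one>\<^bsub>Fix_d L a\<^esub> = a"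
  by (simp add: mv_one_def Fix_d_def d_map_def mv_times_def neg_neg closed zero_plus)

lemma one_Fix_g: "a \<in> carrier L \<Longrightarrow> a \<oplus> a = a \<Longrightarrow> \<one>\<^bsub>Fix_g L a\<^esub> = \<one>"
  by (simp add: mv_one_def Fix_g_def g_map_def plus_neg_self[unfolded mv_one_def])

end

end

theory Submission
  imports Defs
begin

text \<open>The isomorphism is \<open>x \<mapsto> (x \<odot> a, a \<oplus> x)\<close>, with inverse
  \<open>(u, v) \<mapsto> u \<oplus> (v \<odot> \<sim> a)\<close>. It is injective because the complement \<open>\<sim> a\<close> of the Boolean
  element \<open>a\<close> splits every inequality: \<open>x \<preceq> y\<close> as soon as \<open>x \<preceq> a \<oplus> y\<close> and \<open>x \<preceq> \<sim> a \<oplus> y\<close>.\<close>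

context mv_algebra
begin

lemma le_refl: "x \<in> carrier L \<Longrightarrow> x \<preceq> x"
  by (simp add: le_def neg_plus_self)

text \<open>By \<open>le_split\<close>, \<open>t\<close> has the form \<open>a \<oplus> z\<close>,
  and idempotence of \<open>a\<close> absorbs the extra summand.\<close>

lemma boolean_plus_absorb:
  assumes "a \<in> boolean_center L" and "a \<preceq> t" and t: "t \<in> carrier L"
  shows "a \<oplus> t = t"
proof -
  have a: "a \<in> carrier L" "a \<oplus> a = a" using assms by (auto simp: boolean_center_def)
  obtain z where "z \<in> carrier L" "t = a \<oplus> z" using le_split assms a by blast
  then show ?thesis using a by (simp add: plus_assoc[symmetric])
qed

text \<open>Since \<open>x \<odot> a \<preceq> a\<close>, monotonicity bounds the sum by
  \<open>a \<oplus> a = a\<close>. Hence \<open>g_map L a\<close> sends every fixed point of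
  \<open>d_map L a\<close> to \<open>a\<close>.\<close>

lemma boolean_plus_times:
  assumes "a \<in> boolean_center L" and x: "x \<in> carrier L"
  shows "a \<oplus> (x \<odot> a) = a"
proof (rule le_antisym)
  have a: "a \<in> carrier L" "a \<oplus> a = a" using assms by (auto simp: boolean_center_def)
  have "x \<odot> a \<preceq> a" using a x times_le by (metis times_comm)
  then show "a \<oplus> (x \<odot> a) \<preceq> a"
    using plus_mono[of a a "x \<odot> a" a] a x by (simp add: le_refl times_closed)
  show "a \<preceq> a \<oplus> (x \<odot> a)" using a x by (intro le_plus times_closed)
qed (use assms in \<open>auto simp: boolean_center_def closed times_closed\<close>)

lemma boolean_le_cases:
  assumes "a \<in> boolean_center L" and x: "x \<in> carrier L" and y: "y \<in> carrier L"
    and "x \<preceq> a \<oplus> y" and "x \<preceq> \<sim> a \<oplus> y"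
  shows "x \<preceq> y"
proof -
  have a: "a \<in> carrier L" using assms by (auto simp: boolean_center_def)
  \<comment> \<open>Regrouping the summands of \<open>x \<preceq> \<sim> a \<oplus> y\<close> gives
    this bound. Absorbing \<open>a\<close> into \<open>\<sim> x \<oplus> y\<close> then turns
    \<open>x \<preceq> a \<oplus> y\<close> into the goal.\<close>
  have "a \<preceq> \<sim> x \<oplus> y"
    using assms a by (simp add: le_def plus_left_comm closed)
  then have "a \<oplus> (\<sim> x \<oplus> y) = \<sim> x \<oplus> y"
    using assms by (intro boolean_plus_absorb closed)
  then show ?thesis
    using assms a by (simp add: le_def plus_left_comm closed)
qed

text \<open>The hypotheses are symmetric in \<open>x\<close> and \<open>y\<close>, so antisymmetry
  upgrades the conclusion to equality, which is injectivity of the pairing.\<close>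

lemma le_if_times_eq_plus_eq:
  assumes "a \<in> boolean_center L" and x: "x \<in> carrier L" and y: "y \<in> carrier L"
    and times: "x \<odot> a = y \<odot> a" and plus: "a \<oplus> x = a \<oplus> y"
  shows "x \<preceq> y"
proof (rule boolean_le_cases)
  have a: "a \<in> carrier L" using assms by (auto simp: boolean_center_def)
  show "x \<preceq> a \<oplus> y" using le_plus[of x a] a x plus by (simp add: plus_comm)
  \<comment> \<open>Once \<open>x \<odot> a\<close> is bounded by \<open>y\<close>, the adjunction
    \<open>times_le_iff\<close> moves \<open>a\<close> to the right as
    \<open>\<sim> a\<close>.\<close>
  have "x \<odot> a \<preceq> y" using times times_le a y by simp
  then show "x \<preceq> \<sim> a \<oplus> y" using a x y by (simp add: times_le_iff)
qed fact+

lemma d_map_g_map_inj: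
  assumes "a \<in> boolean_center L"
  shows "inj_on (\<lambda>x. (d_map L a x, g_map L a x)) (carrier L)"
  using le_if_times_eq_plus_eq[OF assms]
  by (intro inj_onI le_antisym) (auto simp: d_map_def g_map_def)

lemma d_map_g_map_glue:
  assumes "a \<in> boolean_center L"
    and "u \<in> Fix (d_map L a) L" and "v \<in> Fix (g_map L a) L"
  shows "d_map L a (u \<oplus> (v \<odot> \<sim> a)) = u" and "g_map L a (u \<oplus> (v \<odot> \<sim> a)) = v"
proof -
  have a: "a \<in> carrier L" using assms by (auto simp: boolean_center_def)
  have u: "u \<in> carrier L" "u \<odot> a = u" using assms by (auto simp: Fix_def d_map_def)
  have v: "v \<in> carrier L" "a \<oplus> v = v" using assms by (auto simp: Fix_def g_map_def)
  have "v \<odot> \<zero> = \<zero>"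
    using v by (simp add: mv_times_def flip: mv_one_def) (simp add: plus_one neg_one closed)
  \<comment> \<open>Multiplication by the Boolean \<open>a\<close> distributes over the sum, so only
    \<open>u \<odot> a = u\<close> survives.\<close>
  then have "(v \<odot> \<sim> a) \<odot> a = \<zero>"
    using a v by (simp add: times_assoc closed times_neg_self)
  then show "d_map L a (u \<oplus> (v \<odot> \<sim> a)) = u"
    using a u v assms by (simp add: d_map_def plus_times_boolean times_closed closed plus_zero)
  have "a \<oplus> u = a" using boolean_plus_times[OF assms(1) u(1)] u by simp
  moreover have "a \<oplus> (v \<odot> \<sim> a) = v"
  proof -
    have "a \<preceq> v" using le_plus[of a v] a v by simp
    \<comment> \<open>The left side is the join of \<open>v\<close> and \<open>a\<close>, and
      \<open>\<sim> (\<sim> v \<oplus> a)\<close> is \<open>v \<odot> \<sim> a\<close>. The axiom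
      \<open>lukasiewicz\<close> makes the join symmetric, and \<open>a \<preceq> v\<close>
      collapses it to \<open>v\<close>.\<close>
    then have "\<sim> (\<sim> v \<oplus> a) \<oplus> a = v"
      using lukasiewicz[of v a] a v by (simp add: le_def neg_one zero_plus)
    then show ?thesis using a v by (simp add: mv_times_def neg_neg plus_comm closed)
  qed
  ultimately show "g_map L a (u \<oplus> (v \<odot> \<sim> a)) = v"
    using a u v by (simp add: g_map_def times_closed closed flip: plus_assoc)
qed

lemma d_map_g_map_bij:
  assumes "a \<in> boolean_center L"
  shows "bij_betw (\<lambda>x. (d_map L a x, g_map L a x)) (carrier L)
    (carrier (Fix_d L a) \<times> carrier (Fix_g L a))"
  unfolding bij_betw_def
proof (intro conjI subset_antisym subsetI)
  show "inj_on (\<lambda>x. (d_map L a x, g_map L a x)) (carrier L)"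
    using assms by (rule d_map_g_map_inj)
  fix p
  show "p \<in> carrier (Fix_d L a) \<times> carrier (Fix_g L a)"
    if "p \<in> (\<lambda>x. (d_map L a x, g_map L a x)) ` carrier L"
    using that d_map_hom(2)[OF assms] g_map_hom(2)[OF assms] by auto
  assume "p \<in> carrier (Fix_d L a) \<times> carrier (Fix_g L a)"
  then obtain u v where p: "p = (u, v)"
    and uv: "u \<in> Fix (d_map L a) L" "v \<in> Fix (g_map L a) L"
    by (auto simp: Fix_d_def Fix_g_def)
  \<comment> \<open>This element is the preimage of \<open>(u, v)\<close>:
    \<open>d_map_g_map_glue\<close> recovers both coordinates from it.\<close>
  have "u \<oplus> (v \<odot> \<sim> a) \<in> carrier L"
    using assms uv by (auto simp: Fix_def boolean_center_def closed times_closed)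
  then show "p \<in> (\<lambda>x. (d_map L a x, g_map L a x)) ` carrier L"
    using d_map_g_map_glue[OF assms uv] p by (metis (mono_tags, lifting) image_eqI)
qed

end

lemma mv_hom_prod:
  assumes "f \<in> mv_hom L M" and "g \<in> mv_hom L N"
  shows "(\<lambda>x. (f x, g x)) \<in> mv_hom L (M \<times>\<^sub>M\<^sub>V N)"
  using assms by (auto simp: mv_hom_def mv_prod_def)

theorem theorem4p18:
  fixes L :: "('a, 'm) mv_struct_scheme" and a :: 'a
  assumes "mv_algebra L"
    and "a \<in> boolean_center L"
  shows "L \<cong>\<^sub>M\<^sub>V Fix_d L a \<times>\<^sub>M\<^sub>V Fix_g L a"
proof -
  interpret mv_algebra L by fact
  have "(\<lambda>x. (d_map L a x, g_map L a x)) \<in> mv_iso L (Fix_d L a \<times>\<^sub>M\<^sub>V Fix_g L a)"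
    using mv_hom_prod[OF d_map_hom(1) g_map_hom(1)] d_map_g_map_bij assms(2)
    by (simp add: mv_iso_def mv_prod_def)
  then show ?thesis by (auto simp: mv_isomorphic_def)
qed

end
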